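(* Let $0<\gamma<\bar\gamma<2$. Suppose that, from iteration $k(j)$ through iteration $k(j)+\eta$, the level values remain constant and underestimate $f^\star$ (that is, $\bar f_{k(j)}=\bar f_{k(j)+1}=\dots=\bar f_{k(j)+\eta}<f^\star$), and that $\{x^k\}_{k=k(j)}^{k(j)+\eta}\subset\mathcal X$ is generated iteratively by $x^{k+1}=P_{\mathcal X}(x^k-s^kg^k)$ using subgradients $g^k$ of $f$ at $x^k$ and stepsizes $s^k=\gamma\,\frac{f(x^k)-\bar f_k}{\|g^k\|^2}$, $k=k(j),\dots,k(j)+\eta$. Consider the PSVD problem, i.e. the constraint satisfaction problem with decision vector $x\in\mathbb R^n$ given by $$(g^{\kappa})^\top x\le (g^{\kappa})^\top x^{\kappa}-\frac1{\bar\gamma}s^{\kappa}\|g^{\kappa}\|^2,\qquad \kappa=k(j),k(j)+1,\dots,k(j)+\eta.$$ If this problem is infeasible (no $x\in\mathbb R^n$ satisfies all the inequalities), then there exists $\kappa\in\{k(j),k(j)+1,\dots,k(j)+\eta\}$ such that $$s^\kappa>\bar\gamma\cdot\frac{f(x^\kappa)-f^\star}{\|g^\kappa\|^2},$$ and the new level value $$\bar f'=\frac{\gamma}{\bar\gamma}\bar f_{k(j)+\eta}+\Big(1-\frac{\gamma}{\bar\gamma}\Big)\min_{\kappa\in\{k(j),k(j)+1,\dots,k(j)+\eta\}}f(x^\kappa)$$ satisfies $\bar f_{k(j)+\eta}<\bar f'<f^\star$.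
   Context: $f:\mathbb R^n\to\mathbb R$ is convex (possibly non-smooth), $\mathcal X\subseteq\mathbb R^n$ is nonempty, closed and convex, $f^\star:=\inf_{x\in\mathcal X}f(x)>-\infty$, and $\mathcal X^\star:=\{x\in\mathcal X: f(x)=f^\star\}$ is nonempty. $P_{\mathcal X}$ is the Euclidean projection onto $\mathcal X$ and $\|\cdot\|$ the Euclidean norm. A subgradient of $f$ at $x^k$ is a vector $g^k$ with $f(x)\ge f(x^k)+(g^k)^\top(x-x^k)$ for all $x\in\mathcal X$. A level value $\bar f_k$ is a real number serving as an estimate of $f^\star$ at iteration $k$. The stepsize formula presupposes $g^k\ne0$. Here $k(j)$ and $\eta\ge 0$ are integers. *)

theory Defs
  imports "HOL-Analysis.Analysis"
begin

definition opt_value :: "(real ^ 'n \<Rightarrow> real) \<Rightarrow> (real ^ 'n) set \<Rightarrow> real"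
  where "opt_value f X = (INF x\<in>X. f x)"

definition opt_set :: "(real ^ 'n \<Rightarrow> real) \<Rightarrow> (real ^ 'n) set \<Rightarrow> (real ^ 'n) set"
  where "opt_set f X = {x \<in> X. f x = opt_value f X}"

(* The subgradient inequality is only required against points of the constraint set X. *)
definition is_subgradient ::
    "(real ^ 'n \<Rightarrow> real) \<Rightarrow> (real ^ 'n) set \<Rightarrow> real ^ 'n \<Rightarrow> real ^ 'n \<Rightarrow> bool"
  where "is_subgradient f X y g \<longleftrightarrow> (\<forall>x\<in>X. f x \<ge> f y + g \<bullet> (x - y))"

(* The decision vector ranges over the whole space, not just over the constraint set
   of the optimization problem; K is the set of iteration indices of the inequalities. *)
definition psvd_solutions ::
    "real \<Rightarrow> (int \<Rightarrow> real ^ 'n) \<Rightarrow> (int \<Rightarrow> real ^ 'n) \<Rightarrow> (int \<Rightarrow> real) \<Rightarrow> int set \<Rightarrow> (real ^ 'n) set"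
  where "psvd_solutions \<gamma>b x g s K =
    {z. \<forall>\<kappa>\<in>K. g \<kappa> \<bullet> z \<le> g \<kappa> \<bullet> x \<kappa> - 1 / \<gamma>b * s \<kappa> * (norm (g \<kappa>))\<^sup>2}"

end

theory Submission
  imports Defs
begin

text \<open>
  If the PSVD problem is infeasible, then a minimizer \<open>z\<close> of \<open>f\<close> over \<open>X\<close>
  violates the inequality of some index \<open>\<kappa>\<close>. Since \<open>z\<close> lies in \<open>X\<close>, the subgradient inequality at
  \<open>x \<kappa>\<close> bounds \<open>g \<kappa> \<bullet> (z - x \<kappa>)\<close> from above by \<open>f\<^sup>\<star> - f (x \<kappa>)\<close>, where \<open>f\<^sup>\<star>\<close> is the optimal value;
  the violation therefore says that \<open>\<gamma>b * (f (x \<kappa>) - f\<^sup>\<star>) < s \<kappa> * (norm (g \<kappa>))\<^sup>2\<close>, which is the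
  claim on the stepsize.

  The stepsize rule turns the right-hand side into \<open>\<gamma> * (f (x \<kappa>) - fbar)\<close>. Solving for \<open>f\<^sup>\<star>\<close>, the
  convex combination of \<open>fbar\<close> and \<open>f (x \<kappa>)\<close> with weights \<open>\<gamma> / \<gamma>b\<close> and \<open>1 - \<gamma> / \<gamma>b\<close> lies
  strictly below \<open>f\<^sup>\<star>\<close>; replacing \<open>f (x \<kappa>)\<close> by the smallest of the observed values only lowers it.
  It stays strictly above \<open>fbar\<close> because every observed value is at least \<open>f\<^sup>\<star> > fbar\<close> and the
  second weight is positive.
\<close>

lemma opt_value_le:
  assumes "bdd_below (f ` X)" and "y \<in> X"
  shows "opt_value f X \<le> f y"
  using assms unfolding opt_value_def by (rule cINF_lower)

text \<open>
  The subgradient inequality places every minimizer in the half-space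
  \<open>g \<bullet> (z - y) \<le> f\<^sup>\<star> - f y\<close>. The PSVD cut asks for depth \<open>s * (norm g)\<^sup>2 / \<gamma>b\<close> instead, so a
  minimizer can only violate it if that depth exceeds the gap \<open>f y - f\<^sup>\<star>\<close>.
\<close>
lemma violated_cut_imp_large_step:
  assumes "is_subgradient f X y g" and "z \<in> opt_set f X" and "\<gamma>b > 0"
    and "\<not> g \<bullet> z \<le> g \<bullet> y - 1 / \<gamma>b * s * (norm g)\<^sup>2"
  shows "\<gamma>b * (f y - opt_value f X) < s * (norm g)\<^sup>2"
proof -
  have "opt_value f X \<ge> f y + g \<bullet> (z - y)"
    using assms(1,2) by (auto simp: is_subgradient_def opt_set_def)
  then have "f y - opt_value f X < s * (norm g)\<^sup>2 / \<gamma>b"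
    using assms(4) by (simp add: inner_diff_right)
  then show ?thesis
    using assms(3) by (simp add: field_simps)
qed

theorem theorem2p3:
  fixes f :: "real ^ 'n \<Rightarrow> real"
    and X :: "(real ^ 'n) set"
    and x g :: "int \<Rightarrow> real ^ 'n"
    and s fbar :: "int \<Rightarrow> real"
    and \<gamma> \<gamma>b :: real
    and kj \<eta> :: int
  assumes "convex_on UNIV f"
    and "X \<noteq> {}" and "closed X" and "convex X"
    and "bdd_below (f ` X)"
    and "opt_set f X \<noteq> {}"
    and "0 < \<gamma>" and "\<gamma> < \<gamma>b" and "\<gamma>b < 2"
    and "\<eta> \<ge> 0"
    and "\<And>k. k \<in> {kj..kj + \<eta>} \<Longrightarrow> fbar k = fbar kj"
    and "fbar kj < opt_value f X"
    and "\<And>k. k \<in> {kj..kj + \<eta>} \<Longrightarrow> x k \<in> X"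
    and "\<And>k. k \<in> {kj..kj + \<eta>} \<Longrightarrow> is_subgradient f X (x k) (g k)"
    and "\<And>k. k \<in> {kj..kj + \<eta>} \<Longrightarrow> g k \<noteq> 0"
    and "\<And>k. k \<in> {kj..kj + \<eta>} \<Longrightarrow> s k = \<gamma> * ((f (x k) - fbar k) / (norm (g k))\<^sup>2)"
    and "\<And>k. k \<in> {kj..kj + \<eta>} \<Longrightarrow> x (k + 1) = closest_point X (x k - s k *\<^sub>R g k)"
    and "psvd_solutions \<gamma>b x g s {kj..kj + \<eta>} = {}"
  shows "(\<exists>\<kappa>\<in>{kj..kj + \<eta>}. s \<kappa> > \<gamma>b * ((f (x \<kappa>) - opt_value f X) / (norm (g \<kappa>))\<^sup>2)) \<and>
    (let f' = \<gamma> / \<gamma>b * fbar (kj + \<eta>) +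
              (1 - \<gamma> / \<gamma>b) * Min ((\<lambda>\<kappa>. f (x \<kappa>)) ` {kj..kj + \<eta>})
     in fbar (kj + \<eta>) < f' \<and> f' < opt_value f X)"
proof -
  let ?K = "{kj..kj + \<eta>}" and ?F = "opt_value f X"
  have pos: "\<gamma>b > 0" and weight: "0 < 1 - \<gamma> / \<gamma>b"
    using assms(7,8) by auto
  obtain z where z: "z \<in> opt_set f X"
    using assms(6) by blast
  moreover have "z \<notin> psvd_solutions \<gamma>b x g s ?K"
    using assms(18) by simp
  ultimately obtain \<kappa> where \<kappa>: "\<kappa> \<in> ?K"
    and cut: "\<not> g \<kappa> \<bullet> z \<le> g \<kappa> \<bullet> x \<kappa> - 1 / \<gamma>b * s \<kappa> * (norm (g \<kappa>))\<^sup>2"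
    unfolding psvd_solutions_def by blast
  have norm_pos: "(norm (g \<kappa>))\<^sup>2 > 0"
    using assms(15)[OF \<kappa>] by simp
  have step: "\<gamma>b * (f (x \<kappa>) - ?F) < s \<kappa> * (norm (g \<kappa>))\<^sup>2"
    using violated_cut_imp_large_step[OF assms(14)[OF \<kappa>] z pos cut] .
  then have large: "s \<kappa> > \<gamma>b * ((f (x \<kappa>) - ?F) / (norm (g \<kappa>))\<^sup>2)"
    using norm_pos by (simp add: pos_divide_less_eq)

  have level: "fbar (kj + \<eta>) = fbar kj"
    using assms(10) by (intro assms(11)) simp
  define m where "m = Min ((\<lambda>\<kappa>. f (x \<kappa>)) ` ?K)"
  have m_le: "m \<le> f (x \<kappa>)"
    unfolding m_def using \<kappa> by (intro Min_le) auto
  have "m \<in> (\<lambda>\<kappa>. f (x \<kappa>)) ` ?K"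
    unfolding m_def using \<kappa> by (intro Min_in) auto
  then have m_ge: "?F \<le> m"
    using opt_value_le[OF assms(5)] assms(13) by auto

  have "s \<kappa> * (norm (g \<kappa>))\<^sup>2 = \<gamma> * (f (x \<kappa>) - fbar kj)"
    using assms(16)[OF \<kappa>] assms(11)[OF \<kappa>] norm_pos by simp
  then have below: "\<gamma> / \<gamma>b * fbar kj + (1 - \<gamma> / \<gamma>b) * f (x \<kappa>) < ?F"
    using step pos by (simp add: field_simps)
  have "(1 - \<gamma> / \<gamma>b) * m \<le> (1 - \<gamma> / \<gamma>b) * f (x \<kappa>)"
    using m_le weight by (intro mult_left_mono) auto
  with below have upper: "\<gamma> / \<gamma>b * fbar kj + (1 - \<gamma> / \<gamma>b) * m < ?F"
    by linarith
  have "(1 - \<gamma> / \<gamma>b) * fbar kj < (1 - \<gamma> / \<gamma>b) * m"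
    using m_ge assms(12) weight by (intro mult_strict_left_mono) auto
  then have lower: "fbar kj < \<gamma> / \<gamma>b * fbar kj + (1 - \<gamma> / \<gamma>b) * m"
    by (simp add: algebra_simps)
  show ?thesis
  proof (rule conjI)
    show "\<exists>\<kappa>\<in>?K. s \<kappa> > \<gamma>b * ((f (x \<kappa>) - ?F) / (norm (g \<kappa>))\<^sup>2)"
      using large \<kappa> by (rule bexI)
    show "let f' = \<gamma> / \<gamma>b * fbar (kj + \<eta>) + (1 - \<gamma> / \<gamma>b) * Min ((\<lambda>\<kappa>. f (x \<kappa>)) ` ?K)
      in fbar (kj + \<eta>) < f' \<and> f' < ?F"
      unfolding Let_def level m_def[symmetric] using lower upper by (rule conjI)
  qed
qed

end
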